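(* Let $G_1$ and $G_2$ be connected graphs with $2\le \gamma(G_1)\le \gamma(G_2)$. Then $\zeta(G_1\vee G_2)\ge |V(G_1)|\cdot |V(G_2)|$.
   Context: All graphs are finite and simple. For a graph $G=(V,E)$, a set $S\subseteq V$ is a dominating set if every vertex of $V\setminus S$ is adjacent to some vertex of $S$. The domination number $\gamma(G)$ is the minimum cardinality of a dominating set; a dominating set of cardinality $\gamma(G)$ is called a $\gamma$-set. The dominion $\zeta(G)$ is the number of $\gamma$-sets of $G$. The join $G_1\vee G_2$ is the graph obtained from the disjoint union of $G_1$ and $G_2$ by adding all edges between $V(G_1)$ and $V(G_2)$. *)

theory Defs
  imports "Graph_Theory.Digraph_Component"
begin

text \<open>
  Finite simple graphs are values \<open>G :: 'a pair_pre_digraph\<close> satisfying \<^locale>\<open>pair_graph\<close>: a finite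
  vertex set \<open>pverts G\<close> with a symmetric irreflexive arc relation \<open>parcs G\<close> on it. An edge \<open>uv\<close> is
  represented by the two arcs \<open>(u, v)\<close> and \<open>(v, u)\<close>.
\<close>

definition dominating_set :: "'a pair_pre_digraph \<Rightarrow> 'a set \<Rightarrow> bool" where
  "dominating_set G S \<longleftrightarrow>
     S \<subseteq> pverts G \<and> (\<forall>v \<in> pverts G - S. \<exists>u \<in> S. (v, u) \<in> parcs G)"

definition domination_number :: "'a pair_pre_digraph \<Rightarrow> nat" where
  "domination_number G = Min {card S | S. dominating_set G S}"

definition gamma_set :: "'a pair_pre_digraph \<Rightarrow> 'a set \<Rightarrow> bool" where
  "gamma_set G S \<longleftrightarrow> dominating_set G S \<and> card S = domination_number G"

definition dominion :: "'a pair_pre_digraph \<Rightarrow> nat" where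
  "dominion G = card {S. gamma_set G S}"

definition graph_join ::
    "'a pair_pre_digraph \<Rightarrow> 'b pair_pre_digraph \<Rightarrow> ('a + 'b) pair_pre_digraph" where
  "graph_join G H =
     \<lparr> pverts = pverts G <+> pverts H,
       parcs = {(Inl u, Inl v) | u v. (u, v) \<in> parcs G}
             \<union> {(Inr u, Inr v) | u v. (u, v) \<in> parcs H}
             \<union> {(Inl u, Inr v) | u v. u \<in> pverts G \<and> v \<in> pverts H}
             \<union> {(Inr v, Inl u) | u v. u \<in> pverts G \<and> v \<in> pverts H} \<rparr>"

lemma pair_graph_graph_join:
  assumes "pair_graph G" and "pair_graph H"
  shows "pair_graph (graph_join G H)"
proof -
  interpret G: pair_graph G by (fact assms(1))
  interpret H: pair_graph H by (fact assms(2))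
  let ?J = "graph_join G H"
  have sub: "parcs ?J \<subseteq> pverts ?J \<times> pverts ?J"
    by (auto simp: graph_join_def dest: G.wellformed' H.wellformed')
  have fin: "finite (pverts ?J)"
    by (simp add: graph_join_def)
  have "symmetric ?J"
    using G.pair_sym_arcs H.pair_sym_arcs
    by (auto simp: symmetric_def sym_def graph_join_def)
  moreover have "fst e \<noteq> snd e" if "e \<in> parcs ?J" for e
    using that by (auto simp: graph_join_def dest: G.pair_no_loops H.pair_no_loops)
  moreover have "finite (parcs ?J)"
    using sub fin by (meson finite_SigmaI finite_subset)
  ultimately show ?thesis
    using sub fin by unfold_locales auto
qed

lemma gamma_set_exists:
  assumes "pair_graph G"
  shows "\<exists>S. gamma_set G S"
proof -
  interpret pair_graph G by (fact assms)
  let ?C = "{card S | S. dominating_set G S}"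
  have "?C \<subseteq> card ` Pow (pverts G)"
    by (auto simp: dominating_set_def)
  then have "finite ?C"
    using finite_subset pair_finite_verts by blast
  moreover have "dominating_set G (pverts G)"
    by (simp add: dominating_set_def)
  ultimately have "Min ?C \<in> ?C"
    by (intro Min_in) auto
  then show ?thesis
    by (auto simp: gamma_set_def domination_number_def)
qed

end

theory Submission
  imports Defs
begin

text \<open>
  Every pair consisting of one vertex from each side dominates the join. A dominating set of the
  join lying entirely on one side already dominates that side, so it has at least two elements, and
  any other dominating set meets both sides. Hence the join has domination number 2 and all the
  mixed pairs are minimum dominating sets.
\<close>

lemma finite_dominating_set_cards:
  assumes "finite (pverts G)"
  shows "finite {card S | S. dominating_set G S}"
  by (rule finite_subset[of _ "card ` Pow (pverts G)"])
     (use assms in \<open>auto simp: dominating_set_def\<close>)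

text \<open>Finiteness of \<open>pverts G\<close> makes the set of candidate cardinalities finite,
  and only then is its \<open>Min\<close> a lower bound.\<close>

lemma domination_number_le_card:
  assumes "finite (pverts G)" and "dominating_set G S"
  shows "domination_number G \<le> card S"
  unfolding domination_number_def
  using assms by (intro Min_le finite_dominating_set_cards) auto

text \<open>The join adds no arcs inside a side, so a left vertex dominated from the left is already
  dominated in \<open>G\<close>.\<close>

lemma dominating_set_graph_join_Inl:
  assumes "dominating_set (graph_join G H) (Inl ` A)"
  shows "dominating_set G A"
  using assms by (fastforce simp: dominating_set_def graph_join_def)

lemma dominating_set_graph_join_Inr:
  assumes "dominating_set (graph_join G H) (Inr ` B)"
  shows "dominating_set H B"
  using assms by (fastforce simp: dominating_set_def graph_join_def)

lemma dominating_set_graph_join_pair: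
  assumes "u \<in> pverts G" and "v \<in> pverts H"
  shows "dominating_set (graph_join G H) {Inl u, Inr v}"
  using assms by (auto simp: dominating_set_def graph_join_def)

lemma card_dominating_set_graph_join_ge_2:
  assumes fin: "finite (pverts G)" "finite (pverts H)"
    and ge: "2 \<le> domination_number G" "2 \<le> domination_number H"
    and dom: "dominating_set (graph_join G H) S"
  shows "2 \<le> card S"
proof -
  have "finite S"
    using dom fin by (auto simp: dominating_set_def graph_join_def intro: finite_subset)
  \<comment> \<open>The empty set falls under the one-sided cases, with an empty preimage.\<close>
  consider A where "S = Inl ` A" | B where "S = Inr ` B" | u v where "Inl u \<in> S" "Inr v \<in> S"
    by (metis Inl_Inr_False subset_imageE subsetI rangeI sumE)
  then show ?thesis
  proof cases
    case 1
    then have "domination_number G \<le> card A"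
      using dom fin by (blast intro: domination_number_le_card dominating_set_graph_join_Inl)
    with 1 ge show ?thesis by (simp add: card_image)
  next
    case 2
    then have "domination_number H \<le> card B"
      using dom fin by (blast intro: domination_number_le_card dominating_set_graph_join_Inr)
    with 2 ge show ?thesis by (simp add: card_image)
  next
    case 3
    then have "card {Inl u, Inr v} \<le> card S"
      using \<open>finite S\<close> by (intro card_mono) auto
    then show ?thesis by simp
  qed
qed

lemma gamma_set_graph_join_pair:
  assumes "pair_graph G" and "pair_graph H"
    and ge: "2 \<le> domination_number G" "2 \<le> domination_number H"
    and "u \<in> pverts G" and "v \<in> pverts H"
  shows "gamma_set (graph_join G H) {Inl u, Inr v}"
proof -
  interpret G: pair_graph G by fact
  interpret H: pair_graph H by fact
  interpret J: pair_graph "graph_join G H"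
    using assms by (intro pair_graph_graph_join)
  have dom: "dominating_set (graph_join G H) {Inl u, Inr v}"
    using assms by (intro dominating_set_graph_join_pair)
  \<comment> \<open>A gamma-set attains the minimum, which turns the bound on all dominating sets
    into a bound on the domination number.\<close>
  obtain S where "gamma_set (graph_join G H) S"
    using gamma_set_exists J.pair_graph_axioms by blast
  then have "2 \<le> domination_number (graph_join G H)"
    using card_dominating_set_graph_join_ge_2[OF G.pair_finite_verts H.pair_finite_verts ge]
    unfolding gamma_set_def by metis
  with domination_number_le_card[OF J.pair_finite_verts dom] dom show ?thesis
    by (simp add: gamma_set_def)
qed

theorem theorem3p2:
  fixes G\<^sub>1 :: "'a pair_pre_digraph" and G\<^sub>2 :: "'b pair_pre_digraph"
  assumes "pair_graph G\<^sub>1" and "pair_graph G\<^sub>2"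
    and "Digraph_Component.connected (with_proj G\<^sub>1)"
    and "Digraph_Component.connected (with_proj G\<^sub>2)"
    and "2 \<le> domination_number G\<^sub>1"
    and "domination_number G\<^sub>1 \<le> domination_number G\<^sub>2"
  shows "dominion (graph_join G\<^sub>1 G\<^sub>2) \<ge> card (pverts G\<^sub>1) * card (pverts G\<^sub>2)"
proof -
  let ?J = "graph_join G\<^sub>1 G\<^sub>2"
  let ?pair = "\<lambda>(u, v). {Inl u, Inr v} :: ('a + 'b) set"
  interpret J: pair_graph ?J
    using assms by (intro pair_graph_graph_join)
  \<comment> \<open>An infinite set would have \<open>card\<close> equal to 0, so
    \<open>card_mono\<close> requires this.\<close>
  have "finite {S. gamma_set ?J S}"
    by (rule finite_subset[of _ "Pow (pverts ?J)"])
       (auto simp: gamma_set_def dominating_set_def)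
  \<comment> \<open>The bound 2 for \<open>G\<^sub>2\<close> comes from chaining the two
    inequalities assumed.\<close>
  moreover have "?pair ` (pverts G\<^sub>1 \<times> pverts G\<^sub>2) \<subseteq> {S. gamma_set ?J S}"
    using assms by (auto intro!: gamma_set_graph_join_pair)
  \<comment> \<open>The tags \<open>Inl\<close> and \<open>Inr\<close> rule out the crosswise
    matching of two equal doubletons.\<close>
  moreover have "inj_on ?pair (pverts G\<^sub>1 \<times> pverts G\<^sub>2)"
    by (auto simp: inj_on_def doubleton_eq_iff)
  ultimately have "card (pverts G\<^sub>1 \<times> pverts G\<^sub>2) \<le> card {S. gamma_set ?J S}"
    by (metis card_image card_mono)
  then show ?thesis
    by (simp add: dominion_def card_cartesian_product)
qed

end
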